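(* Let $\ell\ge 2$ be an integer, let $F$ be a probability distribution on $\mathbb{R}$ with finite variance $\sigma^2$ and mean $\mu$, let $W\sim F$, and let $A\subseteq\mathbb{R}$ be a Borel set with $\mathbb{P}(W\in A)=\ell^{-1}$. Let $\{G_m\}_{m\ge1}$ be a sequence of finite simple graphs, each of girth at least $4$, whose number of edges $n=n(m)$ tends to infinity as $m\to\infty$. For each $m$, let $D_1,\dots,D_n$, $X_1,\dots,X_n$ and $\xi_n$ be obtained from $G_m$, $\ell$, $F$, $A$ by the edge construction described in the context. Suppose there exists a random variable $Y$ such that $\xi_n$ converges in law to $Y$ as $m\to\infty$ (and thus as $n\to\infty$). Then the standardized sample mean $$S_n:=\frac{\sum_{k=1}^n X_k-n\mu}{\sigma\sqrt n}$$ converges in law, as $m\to\infty$, to the random variable $$S^{(\ell)}:=\sqrt{1-r^2}\,Z+r\,Y,$$ where $Z\sim N(0,1)$ is independent of $Y$, and $$r:=\frac{\sqrt{\ell^{-1}(1-\ell^{-1})}\,(\mu_V-\mu_U)}{\sigma},\qquad \mu_U=\mathbb{E}[W\mid W\in A^c],\quad \mu_V=\mathbb{E}[W\mid W\in A].$$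
   Context: Girth of a simple graph: the length of its shortest cycle ($+\infty$ if there is no cycle); girth at least $4$ means the graph has no triangle. Edge construction (for fixed $m$). Let $v(m)$ be the number of vertices of $G_m$, labelled $1,\dots,v(m)$. Let $M_1,\dots,M_{v(m)}$ be i.i.d. uniform on $\{1,2,\dots,\ell\}$, with $M_i$ assigned to vertex $i$. For each edge $\{i,j\}$ of $G_m$ put $D_{i,j}=1$ if $M_i=M_j$ and $D_{i,j}=0$ otherwise. Enumerate the $n$ edges in some order and denote the corresponding variables by $D_1,\dots,D_n$. Set $$\Xi_n=\sum_{k=1}^nD_k,\qquad \xi_n=\frac{\Xi_n-n\ell^{-1}}{\sqrt{n\ell^{-1}(1-\ell^{-1})}}.$$ Let $F_U$ be the conditional law of $W$ given $\{W\in A^c\}$ and $F_V$ the conditional law of $W$ given $\{W\in A\}$. On the same probability space let $U_1,\dots,U_n$ be i.i.d. with law $F_U$ and $V_1,\dots,V_n$ i.i.d. with law $F_V$, such that the families $(U_k)_k$, $(V_k)_k$ and $(M_j)_j$ are mutually independent. Finally define, for $k=1,\dots,n$, $X_k=U_k$ on $\{D_k=0\}$ and $X_k=V_k$ on $\{D_k=1\}$. (Since $0<\ell^{-1}<1$, $W$ is not a.s. constant, so $\sigma>0$.) *)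

theory Defs
  imports "HOL-Probability.Probability" "HOL-Library.Extended_Nat"
begin

section \<open>Simple graphs and girth\<close>

text \<open>An edge is the two-element set of its endpoints.\<close>

definition simple_graph :: "'v set \<Rightarrow> 'v set set \<Rightarrow> bool" where
  "simple_graph V E \<longleftrightarrow> (\<forall>e\<in>E. e \<subseteq> V \<and> card e = 2)"

text \<open>A cycle is given by the list of its pairwise distinct vertices in cyclic order.\<close>

definition graph_cycle :: "'v set set \<Rightarrow> 'v list \<Rightarrow> bool" where
  "graph_cycle E c \<longleftrightarrow> length c \<ge> 3 \<and> distinct c \<and>
     (\<forall>i<length c. {c ! i, c ! (Suc i mod length c)} \<in> E)"

text \<open>The infimum over the empty set is \<open>\<infinity>\<close>, so acyclic graphs have infinite girth.\<close>

definition girth :: "'v set set \<Rightarrow> enat" where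
  "girth E = (INF c\<in>{c. graph_cycle E c}. enat (length c))"


section \<open>Conditioning on an event\<close>

definition cond_law :: "'w measure \<Rightarrow> ('w \<Rightarrow> real) \<Rightarrow> real set \<Rightarrow> real measure" where
  "cond_law Q W B = distr (uniform_measure Q (W -` B \<inter> space Q)) borel W"

definition cond_mean :: "'w measure \<Rightarrow> ('w \<Rightarrow> real) \<Rightarrow> real set \<Rightarrow> real" where
  "cond_mean Q W B = integral\<^sup>L (uniform_measure Q (W -` B \<inter> space Q)) W"


section \<open>The edge construction for a single graph\<close>

text \<open>The sigma-algebra generated by the family \<open>(X i)\<close>, \<open>i \<in> I\<close>.\<close>

definition family_events ::
    "'p measure \<Rightarrow> 'b measure \<Rightarrow> (nat \<Rightarrow> 'p \<Rightarrow> 'b) \<Rightarrow> nat set \<Rightarrow> 'p set set" where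
  "family_events P N X I =
     sigma_sets (space P) (\<Union>i\<in>I. {X i -` B \<inter> space P | B. B \<in> sets N})"

text \<open>
  The graph has vertices \<open>1, \<dots>, v\<close> and edge set \<open>E\<close>, enumerated as \<open>e 1, \<dots>, e n\<close>.
  The members of the families \<open>U\<close>, \<open>V\<close> and \<open>M\<close> outside the index ranges below are
  irrelevant.
\<close>

locale edge_construction = prob_space P
  for P :: "'p measure" +
  fixes v :: nat and E :: "nat set set" and n :: nat and e :: "nat \<Rightarrow> nat set"
    and l :: nat and FU FV :: "real measure"
    and M :: "nat \<Rightarrow> 'p \<Rightarrow> nat" and U V :: "nat \<Rightarrow> 'p \<Rightarrow> real"
  assumes edges_enumerated: "bij_betw e {1..n} E"
    and M_indep: "indep_vars (\<lambda>_. count_space UNIV) M {1..v}"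
    and M_uniform: "\<And>i. i \<in> {1..v} \<Longrightarrow>
          distr P (count_space UNIV) (M i) = measure_pmf (pmf_of_set {1..l})"
    and U_indep: "indep_vars (\<lambda>_. borel) U {1..n}"
    and U_law: "\<And>k. k \<in> {1..n} \<Longrightarrow> distr P borel (U k) = FU"
    and V_indep: "indep_vars (\<lambda>_. borel) V {1..n}"
    and V_law: "\<And>k. k \<in> {1..n} \<Longrightarrow> distr P borel (V k) = FV"
    and families_indep: "indep_sets
          (\<lambda>t. [family_events P borel U {1..n},
                family_events P borel V {1..n},
                family_events P (count_space UNIV) M {1..v}] ! t) {0,1,2}"

text \<open>On an edge \<open>e k = {i, j}\<close> the condition below says \<open>M i = M j\<close>.\<close>

definition edge_D :: "(nat \<Rightarrow> nat set) \<Rightarrow> (nat \<Rightarrow> 'p \<Rightarrow> nat) \<Rightarrow> nat \<Rightarrow> 'p \<Rightarrow> nat" where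
  "edge_D e M k \<omega> = (if \<forall>i\<in>e k. \<forall>j\<in>e k. M i \<omega> = M j \<omega> then 1 else 0)"

definition edge_Xi :: "nat \<Rightarrow> (nat \<Rightarrow> nat set) \<Rightarrow> (nat \<Rightarrow> 'p \<Rightarrow> nat) \<Rightarrow> 'p \<Rightarrow> nat" where
  "edge_Xi n e M \<omega> = (\<Sum>k=1..n. edge_D e M k \<omega>)"

definition edge_xi :: "nat \<Rightarrow> nat \<Rightarrow> (nat \<Rightarrow> nat set) \<Rightarrow> (nat \<Rightarrow> 'p \<Rightarrow> nat) \<Rightarrow> 'p \<Rightarrow> real" where
  "edge_xi l n e M \<omega> =
     (real (edge_Xi n e M \<omega>) - real n * (1 / real l)) /
     sqrt (real n * (1 / real l) * (1 - 1 / real l))"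

definition edge_X ::
    "(nat \<Rightarrow> nat set) \<Rightarrow> (nat \<Rightarrow> 'p \<Rightarrow> nat) \<Rightarrow> (nat \<Rightarrow> 'p \<Rightarrow> real) \<Rightarrow> (nat \<Rightarrow> 'p \<Rightarrow> real)
      \<Rightarrow> nat \<Rightarrow> 'p \<Rightarrow> real" where
  "edge_X e M U V k \<omega> = (if edge_D e M k \<omega> = 0 then U k \<omega> else V k \<omega>)"

end

theory Submission
  imports Defs "HOL-Real_Asymp.Real_Asymp"
begin

text \<open>
  Condition on the vertex labels. Given them, \<open>\<Xi>\<close> of the edge variables have law \<open>F\<^sub>V\<close>, the other
  \<open>n - \<Xi>\<close> have law \<open>F\<^sub>U\<close>, and all are independent, so with \<open>\<theta> = t / (\<sigma> \<surd>n)\<close> the characteristic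
  function of the standardized mean at \<open>t\<close> is the expectation of
  \<open>exp (\<i> t r \<xi>\<^sub>n) \<phi>\<^sub>U(\<theta>) ^ (n - \<Xi>) \<phi>\<^sub>V(\<theta>) ^ \<Xi>\<close>, where \<open>\<phi>\<^sub>U\<close> and \<open>\<phi>\<^sub>V\<close> belong to the centred laws. Convergence of
  \<open>\<xi>\<^sub>n\<close> in law forces \<open>\<Xi> / n\<close> to concentrate at \<open>1 / l\<close>, and by the second-order expansion of
  \<open>\<phi>\<^sub>U\<close> and \<open>\<phi>\<^sub>V\<close> the product of powers tends to \<open>exp (- (1 - r\<^sup>2) t\<^sup>2 / 2)\<close>; the variance
  decomposition \<open>\<sigma>\<^sup>2 = (1 - p) s\<^sub>U + p s\<^sub>V + p (1 - p) (\<mu>\<^sub>V - \<mu>\<^sub>U)\<^sup>2\<close> with \<open>p = 1 / l\<close> identifies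
  this exponent. What remains is the characteristic function of \<open>r Y\<close> times that of an independent
  centred normal variable, and Levy's continuity theorem concludes.
\<close>

section \<open>Characteristic functions and weak convergence\<close>

text \<open>By \<open>char_approx3\<close>, the distance to the quadratic \<open>1 - u / k\<close>,
  multiplied by \<open>k\<close>, is at most \<open>t\<^sup>2 / 6\<close> times the integral of a
  minimum. That minimum tends to 0 pointwise and is dominated by \<open>6 * x\<^sup>2\<close>, so a
  finite second moment suffices. Passing from \<open>1 - u / k\<close> to
  \<open>exp (- u / k)\<close> costs O(1/k^2). The exponential form is chosen because its powers
  multiply exactly.\<close>

lemma (in real_distribution) char_minus_exp_little_o:
  assumes "integrable M (\<lambda>x. x)" "expectation (\<lambda>x. x) = 0"
    and sq: "integrable M (\<lambda>x. x\<^sup>2)" and var: "expectation (\<lambda>x. x\<^sup>2) = s"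
  shows "(\<lambda>k. real k * cmod (char M (t / sqrt (real k)) - complex_of_real (exp (- (t\<^sup>2 * s / 2) / real k))))
           \<longlonglongrightarrow> 0"
proof -
  define u where "u = t\<^sup>2 * s / 2"
  define I where "I k = (LINT x|M. min (6 * x\<^sup>2) (\<bar>t / sqrt (real k)\<bar> * \<bar>x\<bar> ^ 3))" for k
  have s0: "s \<ge> 0"
    using var by (metis (no_types, lifting) integral_nonneg_AE AE_I2 zero_le_power2)
  have bound: "\<forall>\<^sub>F k in sequentially.
      norm (real k * cmod (char M (t / sqrt (real k)) - complex_of_real (exp (- u / real k))))
      \<le> t\<^sup>2 / 6 * I k + real k * \<bar>1 - u / real k - exp (- u / real k)\<bar>"
  proof (rule eventually_mono[OF eventually_gt_at_top[of 0]])
    fix k :: nat assume k: "k > 0"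
    let ?t = "t / sqrt (real k)"
    let ?z = "complex_of_real (1 - ?t\<^sup>2 * s / 2)"
    have "cmod (char M ?t - ?z) \<le> (?t\<^sup>2 / 6) * I k"
      using char_approx3[of s ?t] assms unfolding I_def by simp
    then have 1: "real k * cmod (char M ?t - ?z) \<le> t\<^sup>2 / 6 * I k"
      using k mult_left_mono[of "cmod (char M ?t - ?z)" "(?t\<^sup>2 / 6) * I k" "real k"]
      by (simp add: power_divide)
    have 2: "?z = complex_of_real (1 - u / real k)"
      using k by (simp add: power_divide u_def)
    have "cmod (char M ?t - complex_of_real (exp (- u / real k)))
        \<le> cmod (char M ?t - ?z) + cmod (?z - complex_of_real (exp (- u / real k)))"
      by (rule order_trans[OF _ norm_triangle_ineq]) simp
    also have "cmod (?z - complex_of_real (exp (- u / real k))) = \<bar>1 - u / real k - exp (- u / real k)\<bar>"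
      unfolding 2 of_real_diff[symmetric] norm_of_real ..
    finally have "real k * cmod (char M ?t - complex_of_real (exp (- u / real k)))
      \<le> real k * (cmod (char M ?t - ?z) + \<bar>1 - u / real k - exp (- u / real k)\<bar>)"
      by (rule mult_left_mono) simp
    with 1 show "norm (real k * cmod (char M ?t - complex_of_real (exp (- u / real k))))
      \<le> t\<^sup>2 / 6 * I k + real k * \<bar>1 - u / real k - exp (- u / real k)\<bar>"
      by (simp add: distrib_left)
  qed
  have "(\<lambda>k. min (6 * x\<^sup>2) (\<bar>t / sqrt (real k)\<bar> * \<bar>x\<bar> ^ 3)) \<longlonglongrightarrow> 0" for x :: real
  proof -
    have "(\<lambda>k. \<bar>t / sqrt (real k)\<bar> * \<bar>x\<bar> ^ 3) \<longlonglongrightarrow> \<bar>0\<bar> * \<bar>x\<bar> ^ 3"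
      by (intro tendsto_mult tendsto_const tendsto_rabs) real_asymp
    then have "(\<lambda>k. min (6 * x\<^sup>2) (\<bar>t / sqrt (real k)\<bar> * \<bar>x\<bar> ^ 3)) \<longlonglongrightarrow> min (6 * x\<^sup>2) (\<bar>0\<bar> * \<bar>x\<bar> ^ 3)"
      by (intro tendsto_min tendsto_const)
    then show ?thesis by simp
  qed
  then have "I \<longlonglongrightarrow> (LINT x|M. 0)"
    unfolding I_def using sq
    by (intro integral_dominated_convergence[where w = "\<lambda>x. 6 * x\<^sup>2"]) auto
  then have "I \<longlonglongrightarrow> 0" by simp
  moreover have "(\<lambda>k. real k * \<bar>1 - u / real k - exp (- u / real k)\<bar>) \<longlonglongrightarrow> 0"
  \<comment> \<open>The asymptotic expansion needs the sign of \<open>u\<close>; the degenerate case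
    \<open>t = 0\<close> or \<open>s = 0\<close> is exact.\<close>
  proof (cases "u = 0")
    case False
    then have "u > 0" using s0 by (auto simp: u_def)
    then show ?thesis by real_asymp
  qed simp
  ultimately have "(\<lambda>k. t\<^sup>2 / 6 * I k + real k * \<bar>1 - u / real k - exp (- u / real k)\<bar>) \<longlonglongrightarrow> t\<^sup>2 / 6 * 0 + 0"
    by (intro tendsto_intros)
  then show ?thesis
    using Lim_null_comparison[OF bound] by (simp add: u_def)
qed

text \<open>A tightness statement. Once \<open>b m\<close> exceeds \<open>Suc K\<close>, the
  integrand lies below a fixed bounded continuous function \<open>g K\<close>, whose integrals
  converge to the one under \<open>N'\<close>; that limit is small for large \<open>K\<close> by
  dominated convergence. With \<open>b = sqrt n\<close> it turns convergence in law of \<xi> into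
  concentration of the proportion of monochromatic edges.\<close>

lemma weak_conv_m_rescaled_negligible:
  fixes N :: "nat \<Rightarrow> real measure"
  assumes N: "\<And>m. real_distribution (N m)" "real_distribution N'" and conv: "weak_conv_m N N'"
    and b: "filterlim b at_top sequentially"
  shows "(\<lambda>m. LINT x|N m. min 1 (\<bar>x\<bar> / b m)) \<longlonglongrightarrow> 0"
proof -
  interpret N: real_distribution "N m" for m by (rule N)
  interpret N': real_distribution N' by (rule N)
  \<comment> \<open>The cut-off at 1 gives a bounded test function, as weak convergence requires,
    and \<open>Suc K\<close> avoids division by zero.\<close>
  define g where "g K x = min 1 (\<bar>x\<bar> / real (Suc K))" for K x
  have g01: "0 \<le> g K x" "g K x \<le> 1" for K x
    by (auto simp: g_def)
  have gcont: "isCont (g K) x" for K x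
    unfolding g_def by (intro continuous_intros) auto
  have gm[measurable]: "g K \<in> borel_measurable borel" for K
    unfolding g_def by measurable
  have gint: "integrable (N m) (g K)" for K m
    by (rule N.integrable_const_bound[of _ 1]) (use g01 in auto)
  have lim: "(\<lambda>m. LINT x|N m. g K x) \<longlonglongrightarrow> (LINT x|N'. g K x)" for K
    by (rule weak_conv_imp_integral_bdd_continuous_conv[OF N conv, where B = 1])
       (use g01 gcont in auto)
  have "(\<lambda>K. LINT x|N'. g K x) \<longlonglongrightarrow> (LINT x|N'. 0)"
  proof (rule integral_dominated_convergence[where w = "\<lambda>_. 1"])
    have "(\<lambda>K. g K x) \<longlonglongrightarrow> min 1 0" for x
      unfolding g_def
      by (intro tendsto_min tendsto_const) (real_asymp)
    then show "AE x in N'. (\<lambda>K. g K x) \<longlonglongrightarrow> 0" by simp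
  qed (use g01 in auto)
  then have g0: "(\<lambda>K. LINT x|N'. g K x) \<longlonglongrightarrow> 0" by simp
  show ?thesis
  proof (rule tendstoI)
    fix \<epsilon> :: real assume "\<epsilon> > 0"
    then have "\<forall>\<^sub>F K in sequentially. (LINT x|N'. g K x) < \<epsilon>"
      using order_tendstoD(2)[OF g0] by blast
    then obtain K where K: "(LINT x|N'. g K x) < \<epsilon>"
      by (auto simp: eventually_sequentially)
    have "\<forall>\<^sub>F m in sequentially. (LINT x|N m. g K x) < \<epsilon>"
      using order_tendstoD(2)[OF lim K] .
    moreover have "\<forall>\<^sub>F m in sequentially. b m \<ge> real (Suc K)"
      using b by (simp add: filterlim_at_top)
    ultimately show "\<forall>\<^sub>F m in sequentially. dist (LINT x|N m. min 1 (\<bar>x\<bar> / b m)) 0 < \<epsilon>"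
    proof eventually_elim
      case (elim m)
      have bm: "b m > 0" using elim(2) by linarith
      have le: "min 1 (\<bar>x\<bar> / b m) \<le> g K x" for x
        unfolding g_def by (intro min.mono order_refl divide_left_mono) (use elim(2) bm in auto)
      have "integrable (N m) (\<lambda>x. min 1 (\<bar>x\<bar> / b m))"
        by (rule N.integrable_const_bound[of _ 1]) (use bm in auto)
      then have "(LINT x|N m. min 1 (\<bar>x\<bar> / b m)) \<le> (LINT x|N m. g K x)"
        by (intro integral_mono gint le) auto
      moreover have "(LINT x|N m. min 1 (\<bar>x\<bar> / b m)) \<ge> 0"
        using bm by (intro integral_nonneg_AE) auto
      ultimately show ?case using elim(1) by simp
    qed
  qed
qed

section \<open>Comparing products of powers with exponentials\<close>

lemma exp_minus_lipschitz:
  fixes x y :: real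
  assumes "x \<ge> 0" "y \<ge> 0"
  shows "\<bar>exp (- x) - exp (- y)\<bar> \<le> \<bar>x - y\<bar>"
proof -
  have "exp (- x) - exp (- y) \<le> y - x" if "x \<le> y" "x \<ge> 0" for x y :: real
  proof -
    have "exp (- x) - exp (- y) = exp (- x) * (1 - exp (- (y - x)))"
      by (simp add: algebra_simps flip: exp_add)
    also have "\<dots> \<le> 1 * (1 - exp (- (y - x)))"
      using that by (intro mult_right_mono) auto
    also have "\<dots> \<le> y - x"
      using exp_ge_add_one_self[of "- (y - x)"] unfolding mult_1 by linarith
    finally show ?thesis .
  qed
  from this[of x y] this[of y x] show ?thesis
    using assms by (cases "x \<le> y") (auto simp: abs_if)
qed

text \<open>First \<open>a\<close> and \<open>b\<close> are replaced by
  \<open>exp (- \<alpha> / n)\<close> and \<open>exp (- \<beta> / n)\<close>; all four numbers lie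
  in the unit disc, so each of the at most \<open>n\<close> replacements of a base costs one
  difference of bases. The resulting product is an exponential whose exponent is affine in
  \<open>j / n\<close>. The exponent \<open>j\<close> will be random, so the bound depends on it
  only through \<open>j / n - p\<close>.\<close>

lemma norm_power_product_minus_exp_le:
  fixes a b :: complex and \<alpha> \<beta> p :: real
  assumes a: "cmod a \<le> 1" and b: "cmod b \<le> 1" and nonneg: "\<alpha> \<ge> 0" "\<beta> \<ge> 0"
    and p: "0 \<le> p" "p \<le> 1" and j: "j \<le> n" and n: "n > 0"
  shows "cmod (a ^ (n - j) * b ^ j - complex_of_real (exp (- ((1 - p) * \<alpha> + p * \<beta>))))
    \<le> real n * cmod (a - complex_of_real (exp (- \<alpha> / real n)))
      + real n * cmod (b - complex_of_real (exp (- \<beta> / real n)))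
      + \<bar>\<alpha> - \<beta>\<bar> * \<bar>real j / real n - p\<bar>"
proof -
  define a' b' where "a' = complex_of_real (exp (- \<alpha> / real n))"
    and "b' = complex_of_real (exp (- \<beta> / real n))"
  have le1: "cmod a' \<le> 1" "cmod b' \<le> 1"
    using nonneg by (auto simp: a'_def b'_def)
  \<comment> \<open>One power is exchanged at a time.\<close>
  have "a ^ (n - j) * b ^ j - a' ^ (n - j) * b' ^ j
      = (a ^ (n - j) - a' ^ (n - j)) * b ^ j + a' ^ (n - j) * (b ^ j - b' ^ j)"
    by (simp add: algebra_simps)
  then have "cmod (a ^ (n - j) * b ^ j - a' ^ (n - j) * b' ^ j)
      \<le> cmod (a ^ (n - j) - a' ^ (n - j)) * cmod b ^ j + cmod a' ^ (n - j) * cmod (b ^ j - b' ^ j)"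
    by (metis norm_triangle_ineq norm_mult norm_power)
  also have "\<dots> \<le> cmod (a ^ (n - j) - a' ^ (n - j)) * 1 + 1 * cmod (b ^ j - b' ^ j)"
    using a b le1 by (intro add_mono mult_mono power_le_one) auto
  also have "\<dots> \<le> real (n - j) * cmod (a - a') + real j * cmod (b - b')"
    using norm_power_diff[OF a le1(1)] norm_power_diff[OF b le1(2)] by (simp add: add_mono)
  also have "\<dots> \<le> real n * cmod (a - a') + real n * cmod (b - b')"
    using j by (intro add_mono mult_right_mono) auto
  finally have 1: "cmod (a ^ (n - j) * b ^ j - a' ^ (n - j) * b' ^ j)
      \<le> real n * cmod (a - a') + real n * cmod (b - b')" .
  \<comment> \<open>With weights \<open>1 - q\<close> and \<open>q\<close>, the product of the
    exponentials is exact, and only the exponents at \<open>q\<close> and \<open>p\<close> remain to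
    be compared.\<close>
  define q where "q = real j / real n"
  have q: "0 \<le> q" "q \<le> 1" using j n by (auto simp: q_def)
  have "a' ^ (n - j) * b' ^ j = complex_of_real (exp (- ((1 - q) * \<alpha> + q * \<beta>)))"
    unfolding a'_def b'_def of_real_power[symmetric] of_real_mult[symmetric]
      exp_of_nat_mult[symmetric] exp_add[symmetric]
    using j n by (simp add: q_def of_nat_diff field_simps)
  then have "cmod (a' ^ (n - j) * b' ^ j - complex_of_real (exp (- ((1 - p) * \<alpha> + p * \<beta>))))
      = \<bar>exp (- ((1 - q) * \<alpha> + q * \<beta>)) - exp (- ((1 - p) * \<alpha> + p * \<beta>))\<bar>"
    by (metis norm_of_real of_real_diff)
  also have "\<dots> \<le> \<bar>((1 - q) * \<alpha> + q * \<beta>) - ((1 - p) * \<alpha> + p * \<beta>)\<bar>"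
    using p q nonneg by (intro exp_minus_lipschitz add_nonneg_nonneg mult_nonneg_nonneg) auto
  also have "((1 - q) * \<alpha> + q * \<beta>) - ((1 - p) * \<alpha> + p * \<beta>) = (\<beta> - \<alpha>) * (q - p)"
    by (simp add: algebra_simps)
  also have "\<bar>(\<beta> - \<alpha>) * (q - p)\<bar> = \<bar>\<alpha> - \<beta>\<bar> * \<bar>q - p\<bar>"
    by (simp add: abs_mult abs_minus_commute)
  finally have "cmod (a' ^ (n - j) * b' ^ j - complex_of_real (exp (- ((1 - p) * \<alpha> + p * \<beta>))))
      \<le> \<bar>\<alpha> - \<beta>\<bar> * \<bar>q - p\<bar>" .
  with 1 norm_triangle_ineq[of "a ^ (n - j) * b ^ j - a' ^ (n - j) * b' ^ j"
      "a' ^ (n - j) * b' ^ j - complex_of_real (exp (- ((1 - p) * \<alpha> + p * \<beta>)))"]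
  show ?thesis unfolding a'_def[symmetric] b'_def[symmetric] q_def[symmetric] by simp
qed

section \<open>Centring, index shift and independent sums\<close>

lemma (in real_distribution) char_centered:
  "char M s = iexp (s * c) * char (distr M borel (\<lambda>x. x - c)) s"
proof -
  have "char (distr M borel (\<lambda>x. x - c)) s = (CLINT x|M. iexp (s * (x - c)))"
    unfolding char_def by (subst integral_distr) auto
  then have "iexp (s * c) * char (distr M borel (\<lambda>x. x - c)) s = (CLINT x|M. iexp (s * c) * iexp (s * (x - c)))"
    by simp
  also have "\<dots> = char M s"
    unfolding char_def exp_add[symmetric]
    by (intro Bochner_Integration.integral_cong) (auto simp: algebra_simps)
  finally show ?thesis ..
qed

text \<open>Graphs are indexed from 1, whereas weak convergence is stated for sequences indexed from
  0; the limit does not see the shift.\<close>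

lemma weak_conv_m_Suc_iff: "weak_conv_m (\<lambda>m. N (Suc m)) N' \<longleftrightarrow> weak_conv_m N N'"
  unfolding weak_conv_m_def weak_conv_def
  by (simp add: filterlim_sequentially_Suc[of "\<lambda>m. cdf (N m) x" for x])

lemma (in real_distribution) expectation_square_shift:
  assumes "integrable M (\<lambda>x. x)" "integrable M (\<lambda>x. x\<^sup>2)"
  shows "integrable M (\<lambda>x. (x - c)\<^sup>2)"
    and "expectation (\<lambda>x. (x - c)\<^sup>2) = variance (\<lambda>x. x) + (expectation (\<lambda>x. x) - c)\<^sup>2"
proof -
  have eq: "(x - c)\<^sup>2 = x\<^sup>2 - 2 * c * x + c\<^sup>2" for x c :: real
    by (simp add: power2_eq_square algebra_simps)
  show "integrable M (\<lambda>x. (x - c)\<^sup>2)" for c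
    unfolding eq using assms by simp
  have "expectation (\<lambda>x. (x - c)\<^sup>2) = expectation (\<lambda>x. x\<^sup>2) - 2 * c * expectation (\<lambda>x. x) + c\<^sup>2" for c
    unfolding eq using assms prob_space by (simp del: space_eq_univ)
  \<comment> \<open>The expansion at \<open>c\<close> and at the mean share the same second moment;
    eliminating it gives the bias-variance identity.\<close>
  note this[of c] this[of "expectation (\<lambda>x. x)"]
  then show "expectation (\<lambda>x. (x - c)\<^sup>2) = variance (\<lambda>x. x) + (expectation (\<lambda>x. x) - c)\<^sup>2"
    by algebra
qed

lemma (in real_distribution) char_centered_minus_exp_little_o:
  assumes "integrable M (\<lambda>x. x)" "integrable M (\<lambda>x. x\<^sup>2)"
  shows "(\<lambda>k. real k * cmod (char (distr M borel (\<lambda>x. x - expectation (\<lambda>x. x))) (t / sqrt (real k))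
      - complex_of_real (exp (- (t\<^sup>2 * variance (\<lambda>x. x) / 2) / real k)))) \<longlonglongrightarrow> 0"
proof -
  define m where "m = expectation (\<lambda>x. x)"
  let ?N = "distr M borel (\<lambda>x. x - m)"
  interpret N: real_distribution ?N
    by (intro real_distribution_distr) simp
  have int: "integrable M (\<lambda>x. x - m)" "integrable M (\<lambda>x. (x - m)\<^sup>2)"
    using assms expectation_square_shift(1)[OF assms] by simp_all
  show ?thesis
    unfolding m_def[symmetric]
  proof (rule N.char_minus_exp_little_o)
    show "integrable ?N (\<lambda>x. x)"
      by (rule integrable_distr_eq[THEN iffD2]) (use int in simp_all)
    have "N.expectation (\<lambda>x. x) = expectation (\<lambda>x. x - m)"
      by (rule integral_distr) simp_all
    also have "\<dots> = 0"
      using assms prob_space by (simp add: m_def del: space_eq_univ)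
    finally show "N.expectation (\<lambda>x. x) = 0" .
    show "integrable ?N (\<lambda>x. x\<^sup>2)"
      by (rule integrable_distr_eq[THEN iffD2]) (use int in simp_all)
    show "N.expectation (\<lambda>x. x\<^sup>2) = expectation (\<lambda>x. (x - m)\<^sup>2)"
      by (rule integral_distr) simp_all
  qed
qed

text \<open>The characteristic function of an independent sum factorizes, and the normal factor is
  explicit. This is the limit that the continuity theorem has to be fed.\<close>

lemma (in prob_space) char_indep_normal_combination:
  assumes YZ: "indep_var borel Y borel Z" and Z: "distr M borel Z = std_normal_distribution"
  shows "char (distr M borel (\<lambda>\<omega>. a * Z \<omega> + r * Y \<omega>)) t
    = char (distr M borel Y) (r * t) * complex_of_real (exp (- (a\<^sup>2 * t\<^sup>2 / 2)))"
proof -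
  have [measurable]: "random_variable borel Y" "random_variable borel Z"
    using YZ by (auto dest: indep_var_rv1 indep_var_rv2)
  have scale: "char (distr M borel (\<lambda>\<omega>. c * X \<omega>)) t = char (distr M borel X) (c * t)"
    if [measurable]: "random_variable borel X" for c and X :: "'a \<Rightarrow> real"
    unfolding char_def by (subst (1 2) integral_distr) (auto simp: mult_ac)
  have "indep_var borel (\<lambda>\<omega>. r * Y \<omega>) borel (\<lambda>\<omega>. a * Z \<omega>)"
    using indep_var_compose[OF YZ, of "\<lambda>y. r * y" borel "\<lambda>z. a * z" borel] by (simp add: comp_def)
  from char_distr_add[OF this, of t]
  have "char (distr M borel (\<lambda>\<omega>. r * Y \<omega> + a * Z \<omega>)) t
      = char (distr M borel Y) (r * t) * char std_normal_distribution (a * t)"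
    by (simp add: scale Z)
  then show ?thesis
    by (simp add: char_std_normal_distribution power_mult_distrib add.commute)
qed

section \<open>Conditional laws\<close>

text \<open>Because the event has positive probability, conditioning on it is the density
  \<open>indicator / prob\<close>, so every integral against the conditional law becomes a weighted
  integral over the original space.\<close>

lemma (in prob_space)
  fixes W :: "'a \<Rightarrow> real" and f :: "real \<Rightarrow> real"
  assumes [measurable]: "W \<in> borel_measurable M" "B \<in> sets borel"
    and pos: "prob (W -` B \<inter> space M) > 0"
  shows real_distribution_cond_law: "real_distribution (cond_law M W B)"
    and integral_cond_law: "f \<in> borel_measurable borel \<Longrightarrow> integral\<^sup>L (cond_law M W B) f
      = expectation (\<lambda>\<omega>. f (W \<omega>) * indicator B (W \<omega>)) / prob (W -` B \<inter> space M)"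
    and integrable_cond_law: "integrable M (\<lambda>\<omega>. f (W \<omega>)) \<Longrightarrow> f \<in> borel_measurable borel \<Longrightarrow> integrable (cond_law M W B) f"
proof -
  let ?B = "W -` B \<inter> space M"
  have B[measurable]: "?B \<in> sets M" by measurable
  have inv: "1 / ennreal (prob ?B) = ennreal (1 / prob ?B)"
    using divide_ennreal[of 1 "prob ?B"] pos by simp
  have um: "uniform_measure M ?B = density M (\<lambda>\<omega>. ennreal (indicator ?B \<omega> / prob ?B))"
    unfolding uniform_measure_def
    using pos by (intro density_cong) (auto simp: emeasure_eq_measure inv split: split_indicator)
  interpret u: prob_space "uniform_measure M ?B"
    using pos by (intro prob_space_uniform_measure) (auto simp: emeasure_eq_measure)
  show "real_distribution (cond_law M W B)"
    unfolding cond_law_def by (intro u.real_distribution_distr) simp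
  show "integral\<^sup>L (cond_law M W B) f
      = expectation (\<lambda>\<omega>. f (W \<omega>) * indicator B (W \<omega>)) / prob ?B"
    if [measurable]: "f \<in> borel_measurable borel"
  proof -
    have "integral\<^sup>L (cond_law M W B) f = integral\<^sup>L (uniform_measure M ?B) (\<lambda>\<omega>. f (W \<omega>))"
      unfolding cond_law_def by (subst integral_distr) simp_all
    also have "\<dots> = expectation (\<lambda>\<omega>. indicator ?B \<omega> / prob ?B * f (W \<omega>))"
      unfolding um by (subst integral_density) auto
    also have "\<dots> = expectation (\<lambda>\<omega>. f (W \<omega>) * indicator B (W \<omega>) / prob ?B)"
      by (intro Bochner_Integration.integral_cong) (auto split: split_indicator)
    finally show ?thesis by simp
  qed
  show "integrable (cond_law M W B) f" if i: "integrable M (\<lambda>\<omega>. f (W \<omega>))" and [measurable]: "f \<in> borel_measurable borel"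
  proof -
    have "integrable M (\<lambda>\<omega>. indicator ?B \<omega> / prob ?B * f (W \<omega>))"
      using integrable_real_mult_indicator[OF B i]
      by (simp add: mult_ac)
    then have "integrable (uniform_measure M ?B) (\<lambda>\<omega>. f (W \<omega>))"
      unfolding um by (subst integrable_density) auto
    then show ?thesis
      unfolding cond_law_def by (subst integrable_distr_eq) simp_all
  qed
qed

text \<open>The law of total expectation over an event and its complement. With the identity and
  with the squared deviation as \<open>f\<close> it yields the decompositions of mean and
  variance.\<close>

lemma (in prob_space) expectation_eq_cond_law_mixture:
  fixes W :: "'a \<Rightarrow> real" and f :: "real \<Rightarrow> real"
  assumes [measurable]: "W \<in> borel_measurable M" "B \<in> sets borel" "f \<in> borel_measurable borel"
    and B: "prob (W -` B \<inter> space M) = p" "0 < p" "p < 1"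
    and f: "integrable M (\<lambda>\<omega>. f (W \<omega>))"
  shows "expectation (\<lambda>\<omega>. f (W \<omega>))
    = (1 - p) * integral\<^sup>L (cond_law M W (- B)) f + p * integral\<^sup>L (cond_law M W B) f"
proof -
  have "W -` (- B) \<inter> space M = space M - (W -` B \<inter> space M)" by auto
  then have B': "prob (W -` (- B) \<inter> space M) = 1 - p"
    using B by (simp add: prob_compl)
  have int: "integrable M (\<lambda>\<omega>. f (W \<omega>) * indicator C (W \<omega>))" if [measurable]: "C \<in> sets borel" for C
    by (rule Bochner_Integration.integrable_bound[OF f]) (auto split: split_indicator)
  have "(1 - p) * integral\<^sup>L (cond_law M W (- B)) f + p * integral\<^sup>L (cond_law M W B) f
      = expectation (\<lambda>\<omega>. f (W \<omega>) * indicator (- B) (W \<omega>)) + expectation (\<lambda>\<omega>. f (W \<omega>) * indicator B (W \<omega>))"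
    using B B' by (subst (1 2) integral_cond_law) auto
  also have "\<dots> = expectation (\<lambda>\<omega>. f (W \<omega>) * indicator (- B) (W \<omega>) + f (W \<omega>) * indicator B (W \<omega>))"
    by (intro Bochner_Integration.integral_add[symmetric] int) auto
  also have "\<dots> = expectation (\<lambda>\<omega>. f (W \<omega>))"
    by (intro Bochner_Integration.integral_cong) (auto split: split_indicator)
  finally show ?thesis ..
qed

section \<open>The edge construction\<close>

text \<open>\<open>family_events\<close> is a bare set of events that is already a sigma-algebra.
  Viewing it as a measurable space lets measurability with respect to one family alone be
  expressed.\<close>

lemma (in prob_space) sigma_family_events:
  "space (sigma (space M) (family_events M N X I)) = space M"
  "sets (sigma (space M) (family_events M N X I)) = family_events M N X I"
proof -
  have sub: "(\<Union>i\<in>I. {X i -` B \<inter> space M |B. B \<in> sets N}) \<subseteq> Pow (space M)" by auto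
  have "family_events M N X I \<subseteq> Pow (space M)"
    unfolding family_events_def using sigma_sets_into_sp[OF sub] by blast
  then show "sets (sigma (space M) (family_events M N X I)) = family_events M N X I"
    unfolding family_events_def using sigma_sets_sigma_sets_eq[OF sub] by simp
qed (simp add: space_measure_of_conv)

lemma (in prob_space) measurable_family_events:
  assumes "i \<in> I" and X: "X i \<in> measurable M N"
  shows "X i \<in> measurable (sigma (space M) (family_events M N X I)) N"
proof (rule measurableI)
  show "X i x \<in> space N" if "x \<in> space (sigma (space M) (family_events M N X I))" for x
    using that measurable_space[OF X] by (simp add: sigma_family_events)
  show "X i -` B \<inter> space (sigma (space M) (family_events M N X I))
      \<in> sets (sigma (space M) (family_events M N X I))" if "B \<in> sets N" for B
    using that assms(1) unfolding sigma_family_events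
    by (auto simp: family_events_def intro!: sigma_sets.Basic)
qed

section \<open>The random set of monochromatic edges\<close>

context edge_construction
begin

text \<open>This random set holds everything that the sample uses of the labels and has finitely
  many values. Conditioning on the labels thereby becomes a finite sum over its values.\<close>

definition monochromatic :: "'p \<Rightarrow> nat set" where
  "monochromatic \<omega> = {k \<in> {1..n}. edge_D e M k \<omega> \<noteq> 0}"

lemma monochromatic_subset: "monochromatic \<omega> \<subseteq> {1..n}"
  by (auto simp: monochromatic_def)

lemma finite_monochromatic: "finite (monochromatic \<omega>)"
  using monochromatic_subset by (rule finite_subset) simp

lemma edge_Xi_eq_card: "edge_Xi n e M \<omega> = card (monochromatic \<omega>)"
proof -
  have "edge_Xi n e M \<omega> = (\<Sum>k\<in>{1..n}. if k \<in> monochromatic \<omega> then 1 else 0)"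
    unfolding edge_Xi_def by (intro sum.cong) (auto simp: monochromatic_def edge_D_def)
  also have "\<dots> = card ({1..n} \<inter> monochromatic \<omega>)"
    by (simp add: sum.If_cases)
  finally show ?thesis using monochromatic_subset by (simp add: Int_absorb1)
qed

lemma sum_edge_X:
  "(\<Sum>k=1..n. edge_X e M U V k \<omega>)
     = (\<Sum>k\<in>{1..n} - monochromatic \<omega>. U k \<omega>) + (\<Sum>k\<in>monochromatic \<omega>. V k \<omega>)"
proof -
  have "(\<Sum>k=1..n. edge_X e M U V k \<omega>)
      = (\<Sum>k\<in>{1..n} - monochromatic \<omega>. edge_X e M U V k \<omega>) + (\<Sum>k\<in>monochromatic \<omega>. edge_X e M U V k \<omega>)"
    by (intro sum.subset_diff monochromatic_subset) simp
  also have "\<dots> = (\<Sum>k\<in>{1..n} - monochromatic \<omega>. U k \<omega>) + (\<Sum>k\<in>monochromatic \<omega>. V k \<omega>)"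
    by (intro arg_cong2[where f = "(+)"] sum.cong) (auto simp: monochromatic_def edge_X_def)
  finally show ?thesis .
qed

lemma rv_U: "k \<in> {1..n} \<Longrightarrow> random_variable borel (U k)"
  and rv_V: "k \<in> {1..n} \<Longrightarrow> random_variable borel (V k)"
  and rv_M: "i \<in> {1..v} \<Longrightarrow> random_variable (count_space UNIV) (M i)"
  using U_indep V_indep M_indep unfolding indep_vars_def by auto

text \<open>Measurability is needed relative to the label family, not only relative to
  \<open>P\<close>, since it is the label family that is independent of \<open>U\<close> and
  \<open>V\<close>. Simplicity of the graph keeps the endpoints of edges inside
  \<open>{1..v}\<close>.\<close>

lemma pred_monochromatic_eq:
  assumes "simple_graph {1..v} E"
  shows "Measurable.pred (sigma (space P) (family_events P (count_space UNIV) M {1..v}))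
    (\<lambda>\<omega>. monochromatic \<omega> = K)"
    (is "Measurable.pred ?S _")
proof -
  have eE: "e k \<subseteq> {1..v}" if "k \<in> {1..n}" for k
    using assms bij_betwE[OF edges_enumerated] that unfolding simple_graph_def by blast
  have Mm[measurable]: "M i \<in> measurable ?S (count_space UNIV)" if "i \<in> {1..v}" for i
    using that by (intro measurable_family_events rv_M)
  have eq: "Measurable.pred ?S (\<lambda>\<omega>. M i \<omega> = M j \<omega>)" if "i \<in> {1..v}" "j \<in> {1..v}" for i j
  proof -
    note [measurable] = Mm[OF that(1)] Mm[OF that(2)]
    \<comment> \<open>Equality of two labels is a countable union over their common value.\<close>
    have "Measurable.pred ?S (\<lambda>\<omega>. \<exists>c. M i \<omega> = c \<and> M j \<omega> = c)" by measurable
    moreover have "(\<lambda>\<omega>. \<exists>c. M i \<omega> = c \<and> M j \<omega> = c) = (\<lambda>\<omega>. M i \<omega> = M j \<omega>)" by auto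
    ultimately show ?thesis by (simp only:)
  qed
  have "Measurable.pred ?S (\<lambda>\<omega>. edge_D e M k \<omega> \<noteq> 0)" if k: "k \<in> {1..n}" for k
  proof -
    have fin: "finite (e k)" using eE[OF k] finite_subset by blast
    have "Measurable.pred ?S (\<lambda>\<omega>. \<forall>i\<in>e k. \<forall>j\<in>e k. M i \<omega> = M j \<omega>)"
      using eE[OF k] by (intro pred_intros_finite fin eq) auto
    then show ?thesis unfolding edge_D_def by simp
  qed
  note D = this
  show ?thesis
  proof (cases "K \<subseteq> {1..n}")
    case True
    then have "monochromatic \<omega> = K \<longleftrightarrow> (\<forall>k\<in>{1..n}. (edge_D e M k \<omega> \<noteq> 0) = (k \<in> K))" for \<omega>
      unfolding monochromatic_def by blast
    moreover have "Measurable.pred ?S (\<lambda>\<omega>. \<forall>k\<in>{1..n}. (edge_D e M k \<omega> \<noteq> 0) = (k \<in> K))"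
      by (intro pred_intros_finite pred_intros_logic D) auto
    ultimately show ?thesis by simp
  next
    case False
    then have "monochromatic \<omega> \<noteq> K" for \<omega> using monochromatic_subset by blast
    then show ?thesis by simp
  qed
qed

section \<open>The characteristic function of the sample sum given the labels\<close>

lemma expectation_prod_iexp:
  assumes X: "indep_vars (\<lambda>_. borel) X {1..n}" and law: "\<And>k. k \<in> {1..n} \<Longrightarrow> distr P borel (X k) = F"
    and K: "K \<subseteq> {1..n}"
  shows "expectation (\<lambda>\<omega>. \<Prod>k\<in>K. iexp (s * X k \<omega>)) = char F s ^ card K"
proof -
  have rv: "random_variable borel (X k)" if "k \<in> K" for k
    using X K that unfolding indep_vars_def by auto
  have "indep_vars (\<lambda>_. borel) (\<lambda>k \<omega>. iexp (s * X k \<omega>)) K"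
    by (rule indep_vars_compose2[OF indep_vars_subset[OF X K]]) measurable
  then have "expectation (\<lambda>\<omega>. \<Prod>k\<in>K. iexp (s * X k \<omega>)) = (\<Prod>k\<in>K. expectation (\<lambda>\<omega>. iexp (s * X k \<omega>)))"
    using finite_subset[OF K] rv by (intro indep_vars_lebesgue_integral integrable_iexp) auto
  also have "\<dots> = (\<Prod>k\<in>K. char F s)"
  proof (rule prod.cong[OF refl])
    fix k assume k: "k \<in> K"
    then have "char F s = char (distr P borel (X k)) s" using law K by auto
    also have "\<dots> = expectation (\<lambda>\<omega>. iexp (s * X k \<omega>))"
      unfolding char_def using rv[OF k] by (intro integral_distr) auto
    finally show "expectation (\<lambda>\<omega>. iexp (s * X k \<omega>)) = char F s" ..
  qed
  finally show ?thesis by simp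
qed

text \<open>For a fixed value \<open>K\<close>, the three factors are measurable with respect to the
  three independent families, so the expectation of their product splits; independence inside
  \<open>U\<close> and inside \<open>V\<close> then produces the powers.\<close>

lemma expectation_on_monochromatic_eq:
  assumes graph: "simple_graph {1..v} E" and K: "K \<subseteq> {1..n}"
  shows "integrable P (\<lambda>\<omega>. (\<Prod>k\<in>{1..n} - K. iexp (s * U k \<omega>)) * (\<Prod>k\<in>K. iexp (s * V k \<omega>))
            * of_bool (monochromatic \<omega> = K))"
    and "expectation (\<lambda>\<omega>. (\<Prod>k\<in>{1..n} - K. iexp (s * U k \<omega>)) * (\<Prod>k\<in>K. iexp (s * V k \<omega>))
            * of_bool (monochromatic \<omega> = K))
      = char FU s ^ (n - card K) * char FV s ^ card K * expectation (\<lambda>\<omega>. of_bool (monochromatic \<omega> = K))"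
proof -
  \<comment> \<open>Both families are indexed by \<open>{0,1,2}\<close> through list lookup,
    matching the form of \<open>families_indep\<close>.\<close>
  define G where "G = (\<lambda>t. [family_events P borel U {1..n}, family_events P borel V {1..n},
                family_events P (count_space UNIV) M {1..v}] ! t)"
  define T where "T = (\<lambda>t \<omega>. [\<Prod>k\<in>{1..n} - K. iexp (s * U k \<omega>), \<Prod>k\<in>K. iexp (s * V k \<omega>),
      of_bool (monochromatic \<omega> = K)] ! t)"
  have Uf: "U k \<in> measurable (sigma (space P) (G 0)) borel" if "k \<in> {1..n}" for k
    unfolding G_def using that by (simp del: atLeastAtMost_iff add: measurable_family_events rv_U)
  have Vf: "V k \<in> measurable (sigma (space P) (G 1)) borel" if "k \<in> {1..n}" for k
    unfolding G_def using that by (simp del: atLeastAtMost_iff add: measurable_family_events rv_V)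
  have Mf: "Measurable.pred (sigma (space P) (G 2)) (\<lambda>\<omega>. monochromatic \<omega> = K)"
    unfolding G_def using pred_monochromatic_eq[OF graph] by simp
  have T: "T t \<in> borel_measurable (sigma (space P) (G t))" if "t \<in> {0,1,2}" for t
  proof -
    have "T 0 \<in> borel_measurable (sigma (space P) (G 0))"
      unfolding T_def by (simp, intro borel_measurable_prod measurable_compose[OF Uf]) auto
    moreover have "T 1 \<in> borel_measurable (sigma (space P) (G 1))"
      unfolding T_def using K by (simp, intro borel_measurable_prod measurable_compose[OF Vf[simplified]]) auto
    moreover have "T 2 \<in> borel_measurable (sigma (space P) (G 2))"
      unfolding T_def using Mf by simp
    ultimately show ?thesis using that by auto
  qed
  have G: "space (sigma (space P) (G t)) = space P" "sets (sigma (space P) (G t)) = G t" if "t \<in> {0,1,2}" for t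
    using that by (auto simp: G_def sigma_family_events space_measure_of_conv)
  have "G t \<subseteq> events" if "t \<in> {0,1,2}" for t
    using families_indep that unfolding G_def indep_sets_def by blast
  then have rv: "random_variable borel (T t)" if "t \<in> {0,1,2}" for t
    using T[OF that] G[OF that] that unfolding measurable_def by fastforce
  \<comment> \<open>The events generated by \<open>T t\<close> lie in \<open>G t\<close>, and
    independence passes to smaller collections.\<close>
  have "indep_sets (\<lambda>t. {T t -` B \<inter> space P |B. B \<in> sets borel}) {0,1,2}"
  proof (rule indep_sets_mono_sets)
    show "indep_sets G {0,1,2}" using families_indep unfolding G_def .
    show "{T t -` B \<inter> space P |B. B \<in> sets borel} \<subseteq> G t" if "t \<in> {0,1,2}" for t
      using measurable_sets[OF T[OF that]] unfolding G[OF that] by blast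
  qed
  then have ind: "indep_vars (\<lambda>_. borel) T {0,1,2}"
    using rv unfolding indep_vars_def2 by blast
  have bd: "cmod (T t \<omega>) \<le> 1" if "t \<in> {0,1,2}" for t \<omega>
    using that by (auto simp: T_def prod_norm[symmetric])
  have int: "integrable P (T t)" if "t \<in> {0,1,2}" for t
    using rv[OF that] bd[OF that] by (intro integrable_const_bound[of _ 1]) auto
  have prod_T: "(\<Prod>t\<in>{0,1,2}. T t \<omega>) = (\<Prod>k\<in>{1..n} - K. iexp (s * U k \<omega>)) * (\<Prod>k\<in>K. iexp (s * V k \<omega>))
            * of_bool (monochromatic \<omega> = K)" for \<omega>
    by (simp add: T_def mult.assoc)
  show "integrable P (\<lambda>\<omega>. (\<Prod>k\<in>{1..n} - K. iexp (s * U k \<omega>)) * (\<Prod>k\<in>K. iexp (s * V k \<omega>))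
            * of_bool (monochromatic \<omega> = K))"
    using indep_vars_integrable[OF _ ind int] unfolding prod_T by simp
  have "expectation (\<lambda>\<omega>. \<Prod>t\<in>{0,1,2}. T t \<omega>) = (\<Prod>t\<in>{0,1,2}. expectation (T t))"
    using indep_vars_lebesgue_integral[OF _ ind int] by simp
  also have "\<dots> = expectation (T 0) * expectation (T 1) * expectation (T 2)"
    by (simp add: mult.assoc)
  also have "expectation (T 0) = char FU s ^ (n - card K)"
    using expectation_prod_iexp[OF U_indep U_law, of "{1..n} - K" s] K finite_subset[OF K]
    by (simp add: T_def card_Diff_subset)
  also have "expectation (T 1) = char FV s ^ card K"
    using expectation_prod_iexp[OF V_indep V_law K, of s] by (simp add: T_def)
  also have "T 2 = (\<lambda>\<omega>. of_bool (monochromatic \<omega> = K))"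
    by (simp add: T_def)
  finally show "expectation (\<lambda>\<omega>. (\<Prod>k\<in>{1..n} - K. iexp (s * U k \<omega>)) * (\<Prod>k\<in>K. iexp (s * V k \<omega>))
            * of_bool (monochromatic \<omega> = K))
      = char FU s ^ (n - card K) * char FV s ^ card K * expectation (\<lambda>\<omega>. of_bool (monochromatic \<omega> = K))"
    unfolding prod_T .
qed

lemma monochromatic_eq_event:
  assumes "simple_graph {1..v} E"
  shows "Measurable.pred P (\<lambda>\<omega>. monochromatic \<omega> = K)"
proof -
  have "family_events P (count_space UNIV) M {1..v} \<subseteq> events"
    using families_indep unfolding indep_sets_def by force
  then show ?thesis
    using pred_monochromatic_eq[OF assms, of K] unfolding pred_def by (auto simp: sigma_family_events)
qed

lemma rv_edge_Xi:
  assumes "simple_graph {1..v} E"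
  shows "random_variable (count_space UNIV) (edge_Xi n e M)"
proof -
  have "edge_Xi n e M -` {j} \<inter> space P
      = (\<Union>K\<in>{K \<in> Pow {1..n}. card K = j}. {\<omega> \<in> space P. monochromatic \<omega> = K})" for j
    using monochromatic_subset by (auto simp: edge_Xi_eq_card)
  also have "\<dots> j \<in> events" for j
    using monochromatic_eq_event[OF assms] by (intro sets.finite_UN) (auto simp: pred_def)
  finally show ?thesis
    by (simp add: measurable_count_space_eq2_countable)
qed

text \<open>The expectation is split over the values of the random set, evaluated on each piece, and
  reassembled. The value of a piece depends on \<open>K\<close> only through its cardinality, which
  is why only \<open>edge_Xi\<close> survives.\<close>

lemma expectation_iexp_sum_edge_X:
  assumes graph: "simple_graph {1..v} E"
  shows "expectation (\<lambda>\<omega>. iexp (s * (\<Sum>k=1..n. edge_X e M U V k \<omega>)))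
    = expectation (\<lambda>\<omega>. char FU s ^ (n - edge_Xi n e M \<omega>) * char FV s ^ edge_Xi n e M \<omega>)"
proof -
  let ?f = "\<lambda>K \<omega>. (\<Prod>k\<in>{1..n} - K. iexp (s * U k \<omega>)) * (\<Prod>k\<in>K. iexp (s * V k \<omega>))"
  let ?c = "\<lambda>K. char FU s ^ (n - card K) * char FV s ^ card K"
  \<comment> \<open>Exactly one of the indicators is nonzero.\<close>
  have split: "(\<Sum>K\<in>Pow {1..n}. h K * of_bool (monochromatic \<omega> = K)) = h (monochromatic \<omega>)"
    for h :: "nat set \<Rightarrow> complex" and \<omega>
    using monochromatic_subset by (auto simp: of_bool_def if_distrib cong: if_cong)
  have "iexp (s * (\<Sum>k=1..n. edge_X e M U V k \<omega>)) = ?f (monochromatic \<omega>) \<omega>" for \<omega>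
    unfolding sum_edge_X
    by (simp add: distrib_left exp_add sum_distrib_left exp_sum finite_monochromatic)
  then have "expectation (\<lambda>\<omega>. iexp (s * (\<Sum>k=1..n. edge_X e M U V k \<omega>)))
      = expectation (\<lambda>\<omega>. \<Sum>K\<in>Pow {1..n}. ?f K \<omega> * of_bool (monochromatic \<omega> = K))"
    by (simp only: split)
  also have "\<dots> = (\<Sum>K\<in>Pow {1..n}. expectation (\<lambda>\<omega>. ?f K \<omega> * of_bool (monochromatic \<omega> = K)))"
    using expectation_on_monochromatic_eq(1)[OF graph] by (intro Bochner_Integration.integral_sum) auto
  also have "\<dots> = (\<Sum>K\<in>Pow {1..n}. expectation (\<lambda>\<omega>. ?c K * of_bool (monochromatic \<omega> = K)))"
    using expectation_on_monochromatic_eq(2)[OF graph] by (intro sum.cong) auto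
  also have "\<dots> = expectation (\<lambda>\<omega>. \<Sum>K\<in>Pow {1..n}. ?c K * of_bool (monochromatic \<omega> = K))"
  proof (rule Bochner_Integration.integral_sum[symmetric])
    fix K
    have "integrable P (\<lambda>\<omega>. of_bool (monochromatic \<omega> = K) :: complex)"
      using monochromatic_eq_event[OF graph] by (intro integrable_const_bound[of _ 1]) auto
    then show "integrable P (\<lambda>\<omega>. ?c K * of_bool (monochromatic \<omega> = K))" by simp
  qed
  also have "\<dots> = expectation (\<lambda>\<omega>. ?c (monochromatic \<omega>))"
    by (simp only: split)
  finally show ?thesis by (simp only: edge_Xi_eq_card)
qed

section \<open>Measurability of the sample and the quantitative comparison\<close>

lemma rv_edge_X:
  assumes "simple_graph {1..v} E" and k: "k \<in> {1..n}"
  shows "random_variable borel (edge_X e M U V k)"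
proof -
  have "Measurable.pred P (\<lambda>\<omega>. \<exists>K\<in>{K \<in> Pow {1..n}. k \<in> K}. monochromatic \<omega> = K)"
    by (intro pred_intros_finite monochromatic_eq_event assms) auto
  moreover have "(\<exists>K\<in>{K \<in> Pow {1..n}. k \<in> K}. monochromatic \<omega> = K) \<longleftrightarrow> edge_D e M k \<omega> \<noteq> 0" for \<omega>
    using k monochromatic_subset[of \<omega>] by (auto simp: monochromatic_def)
  ultimately have [measurable]: "Measurable.pred P (\<lambda>\<omega>. edge_D e M k \<omega> \<noteq> 0)"
    by simp
  note [measurable] = rv_U[OF k] rv_V[OF k]
  have "(\<lambda>\<omega>. if edge_D e M k \<omega> \<noteq> 0 then V k \<omega> else U k \<omega>) \<in> borel_measurable P"
    by measurable
  moreover have "(\<lambda>\<omega>. if edge_D e M k \<omega> \<noteq> 0 then V k \<omega> else U k \<omega>) = edge_X e M U V k"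
    by (auto simp: edge_X_def)
  ultimately show ?thesis by simp
qed

lemma rv_edge_xi:
  assumes "simple_graph {1..v} E"
  shows "random_variable borel (edge_xi l n e M)"
proof -
  note [measurable] = rv_edge_Xi[OF assms]
  show ?thesis unfolding edge_xi_def by measurable
qed

lemma edge_Xi_le: "edge_Xi n e M \<omega> \<le> n"
  unfolding edge_Xi_eq_card using card_mono[OF _ monochromatic_subset] by simp

text \<open>Centring \<open>FU\<close> and \<open>FV\<close> moves the random shift \<open>(\<mu>\<^sub>V - \<mu>\<^sub>U) (\<Xi> - n / l)\<close> of the conditional mean
  into the factor \<open>iexp (r * t * \<xi>)\<close>; the remaining factor is compared with a constant.\<close>

lemma char_sample_mean_approx:
  fixes \<mu> \<mu>\<^sub>U \<mu>\<^sub>V \<sigma> r s\<^sub>U s\<^sub>V t :: real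
  defines "p \<equiv> 1 / real l" and "\<alpha> \<equiv> (t / \<sigma>)\<^sup>2 * s\<^sub>U / 2" and "\<beta> \<equiv> (t / \<sigma>)\<^sup>2 * s\<^sub>V / 2"
  assumes graph: "simple_graph {1..v} E" and l: "l \<ge> 2" and n: "n > 0" and \<sigma>: "\<sigma> > 0"
    and FU: "real_distribution FU" and FV: "real_distribution FV"
    and \<mu>: "\<mu> = (1 - p) * \<mu>\<^sub>U + p * \<mu>\<^sub>V" and r: "r = sqrt (p * (1 - p)) * (\<mu>\<^sub>V - \<mu>\<^sub>U) / \<sigma>"
    and s: "s\<^sub>U \<ge> 0" "s\<^sub>V \<ge> 0"
  shows "cmod (char (distr P borel (\<lambda>\<omega>. ((\<Sum>k=1..n. edge_X e M U V k \<omega>) - real n * \<mu>) / (\<sigma> * sqrt (real n)))) t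
      - char (distr P borel (edge_xi l n e M)) (r * t) * complex_of_real (exp (- ((1 - p) * \<alpha> + p * \<beta>))))
    \<le> real n * cmod (char (distr FU borel (\<lambda>x. x - \<mu>\<^sub>U)) (t / \<sigma> / sqrt (real n)) - complex_of_real (exp (- \<alpha> / real n)))
      + real n * cmod (char (distr FV borel (\<lambda>x. x - \<mu>\<^sub>V)) (t / \<sigma> / sqrt (real n)) - complex_of_real (exp (- \<beta> / real n)))
      + \<bar>\<alpha> - \<beta>\<bar> * (LINT x|distr P borel (edge_xi l n e M). min 1 (\<bar>x\<bar> / sqrt (real n)))"
proof -
  interpret FU: real_distribution FU by fact
  interpret FV: real_distribution FV by fact
  define \<theta> where "\<theta> = t / \<sigma> / sqrt (real n)"
  define a where "a = char (distr FU borel (\<lambda>x. x - \<mu>\<^sub>U)) \<theta>"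
  define b where "b = char (distr FV borel (\<lambda>x. x - \<mu>\<^sub>V)) \<theta>"
  define c where "c = complex_of_real (exp (- ((1 - p) * \<alpha> + p * \<beta>)))"
  define \<Xi> where "\<Xi> = edge_Xi n e M"
  define \<xi> where "\<xi> = edge_xi l n e M"
  have p: "0 < p" "p < 1" using l by (auto simp: p_def)
  have \<alpha>\<beta>: "\<alpha> \<ge> 0" "\<beta> \<ge> 0" using s by (auto simp: \<alpha>_def \<beta>_def)
  note [measurable] = rv_edge_X[OF graph] rv_edge_xi[OF graph, folded \<xi>_def] rv_edge_Xi[OF graph, folded \<Xi>_def]
  have ab: "cmod a \<le> 1" "cmod b \<le> 1"
    unfolding a_def b_def
    by (auto intro!: real_distribution.cmod_char_le_1 FU.real_distribution_distr FV.real_distribution_distr)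
  have \<Xi>_le: "\<Xi> \<omega> \<le> n" for \<omega> by (simp add: \<Xi>_def edge_Xi_le)
  have \<Xi>_\<xi>: "real (\<Xi> \<omega>) - real n * p = sqrt (p * (1 - p)) * sqrt (real n) * \<xi> \<omega>" for \<omega>
    using p n unfolding \<xi>_def edge_xi_def \<Xi>_def p_def[symmetric]
    by (simp add: real_sqrt_mult mult_ac)
  \<comment> \<open>Since \<mu> is the mixture of the two conditional means, all deterministic
    shifts cancel and leave
    \<open>\<theta> * (\<mu>\<^sub>V - \<mu>\<^sub>U) * (\<Xi> - n * p)\<close>; the factor
    \<open>sqrt (p * (1 - p))\<close> in the standardization of \<Xi> and the definition of
    \<open>r\<close> turn this into \<open>r * t * \<xi>\<close>.\<close>
  have phase: "iexp (- \<theta> * real n * \<mu>) * (iexp (\<theta> * \<mu>\<^sub>U) ^ (n - \<Xi> \<omega>) * iexp (\<theta> * \<mu>\<^sub>V) ^ \<Xi> \<omega>) = iexp (r * t * \<xi> \<omega>)" for \<omega>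
  proof -
    have "- \<theta> * real n * \<mu> + (real (n - \<Xi> \<omega>) * (\<theta> * \<mu>\<^sub>U) + real (\<Xi> \<omega>) * (\<theta> * \<mu>\<^sub>V))
        = \<theta> * (\<mu>\<^sub>V - \<mu>\<^sub>U) * (real (\<Xi> \<omega>) - real n * p)"
      using \<Xi>_le by (simp add: \<mu> of_nat_diff algebra_simps)
    also have "\<dots> = r * t * \<xi> \<omega>"
      unfolding \<Xi>_\<xi> using n \<sigma> by (simp add: \<theta>_def r)
    finally have "r * t * \<xi> \<omega> = - \<theta> * real n * \<mu> + (real (n - \<Xi> \<omega>) * (\<theta> * \<mu>\<^sub>U) + real (\<Xi> \<omega>) * (\<theta> * \<mu>\<^sub>V))" ..
    then show ?thesis
      by (simp only: of_real_add distrib_left exp_add exp_of_nat_mult[symmetric] of_real_mult of_real_of_nat_eq)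
         (simp add: mult_ac)
  qed
  let ?S = "\<lambda>\<omega>. ((\<Sum>k=1..n. edge_X e M U V k \<omega>) - real n * \<mu>) / (\<sigma> * sqrt (real n))"
  have "char (distr P borel ?S) t = expectation (\<lambda>\<omega>. iexp (t * ?S \<omega>))"
    unfolding char_def by (subst integral_distr) auto
  also have "\<dots> = expectation (\<lambda>\<omega>. iexp (- \<theta> * real n * \<mu>) * iexp (\<theta> * (\<Sum>k=1..n. edge_X e M U V k \<omega>)))"
  proof (rule Bochner_Integration.integral_cong[OF refl])
    fix \<omega>
    have "t * ?S \<omega> = - \<theta> * real n * \<mu> + \<theta> * (\<Sum>k=1..n. edge_X e M U V k \<omega>)"
      using \<sigma> n by (simp add: \<theta>_def field_simps)
    then show "iexp (t * ?S \<omega>) = iexp (- \<theta> * real n * \<mu>) * iexp (\<theta> * (\<Sum>k=1..n. edge_X e M U V k \<omega>))"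
      by (simp only: of_real_add distrib_left exp_add)
  qed
  also have "\<dots> = iexp (- \<theta> * real n * \<mu>) * expectation (\<lambda>\<omega>. iexp (\<theta> * (\<Sum>k=1..n. edge_X e M U V k \<omega>)))"
    by simp
  also have "\<dots> = expectation (\<lambda>\<omega>. iexp (- \<theta> * real n * \<mu>) * (char FU \<theta> ^ (n - \<Xi> \<omega>) * char FV \<theta> ^ \<Xi> \<omega>))"
    unfolding expectation_iexp_sum_edge_X[OF graph] \<Xi>_def by simp
  also have "\<dots> = expectation (\<lambda>\<omega>. iexp (r * t * \<xi> \<omega>) * (a ^ (n - \<Xi> \<omega>) * b ^ \<Xi> \<omega>))"
    unfolding phase[symmetric] FU.char_centered[of \<theta> "\<mu>\<^sub>U"] FV.char_centered[of \<theta> "\<mu>\<^sub>V"] a_def b_def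
    by (simp only: power_mult_distrib mult_ac)
  finally have 1: "char (distr P borel ?S) t = expectation (\<lambda>\<omega>. iexp (r * t * \<xi> \<omega>) * (a ^ (n - \<Xi> \<omega>) * b ^ \<Xi> \<omega>))" .
  have 2: "char (distr P borel \<xi>) (r * t) * c = expectation (\<lambda>\<omega>. iexp (r * t * \<xi> \<omega>) * c)"
    unfolding char_def by (subst integral_distr) auto
  have int1: "integrable P (\<lambda>\<omega>. iexp (r * t * \<xi> \<omega>) * (a ^ (n - \<Xi> \<omega>) * b ^ \<Xi> \<omega>))"
    by (rule integrable_const_bound[of _ 1])
       (auto simp: norm_mult norm_power intro!: mult_le_one power_le_one ab)
  have int2: "integrable P (\<lambda>\<omega>. iexp (r * t * \<xi> \<omega>) * c)"
    by (rule integrable_const_bound[of _ "cmod c"]) (auto simp: norm_mult)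
  define \<delta> where "\<delta> = real n * cmod (a - complex_of_real (exp (- \<alpha> / real n)))
      + real n * cmod (b - complex_of_real (exp (- \<beta> / real n)))"
  have int3: "integrable P (\<lambda>\<omega>. min 1 (\<bar>\<xi> \<omega>\<bar> / sqrt (real n)))"
    by (rule integrable_const_bound[of _ 1]) auto
  \<comment> \<open>Both bounds hold: two numbers in the unit interval differ by at most 1, and the
    standardization gives the other bound after dropping \<open>sqrt (p * (1 - p)) \<le> 1\<close>.
    The minimum is the test function shown above to be negligible.\<close>
  have dev: "\<bar>real (\<Xi> \<omega>) / real n - p\<bar> \<le> min 1 (\<bar>\<xi> \<omega>\<bar> / sqrt (real n))" for \<omega>
  proof -
    have "real (\<Xi> \<omega>) / real n \<le> 1" "real (\<Xi> \<omega>) / real n \<ge> 0"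
      using \<Xi>_le[of \<omega>] n by auto
    then have "\<bar>real (\<Xi> \<omega>) / real n - p\<bar> \<le> 1" using p by linarith
    moreover have "real (\<Xi> \<omega>) / real n - p = (real (\<Xi> \<omega>) - real n * p) / real n"
      using n by (simp add: field_simps)
    then have "\<bar>real (\<Xi> \<omega>) / real n - p\<bar> = sqrt (p * (1 - p)) * (\<bar>\<xi> \<omega>\<bar> * (sqrt (real n) / real n))"
      unfolding \<Xi>_\<xi> using p by (simp add: abs_mult)
    moreover have "sqrt (real n) / real n = 1 / sqrt (real n)"
      using n by (simp add: field_simps)
    moreover have "sqrt (p * (1 - p)) \<le> 1" using p by (simp add: mult_le_one)
    then have "sqrt (p * (1 - p)) * (\<bar>\<xi> \<omega>\<bar> / sqrt (real n)) \<le> 1 * (\<bar>\<xi> \<omega>\<bar> / sqrt (real n))"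
      by (intro mult_right_mono) auto
    ultimately show ?thesis by simp
  qed
  have bound: "cmod (iexp (r * t * \<xi> \<omega>) * (a ^ (n - \<Xi> \<omega>) * b ^ \<Xi> \<omega>) - iexp (r * t * \<xi> \<omega>) * c)
      \<le> \<delta> + \<bar>\<alpha> - \<beta>\<bar> * min 1 (\<bar>\<xi> \<omega>\<bar> / sqrt (real n))" for \<omega>
  proof -
    \<comment> \<open>The common phase has modulus one, so only the powers have to be compared with
      \<open>c\<close>.\<close>
    have "cmod (iexp (r * t * \<xi> \<omega>) * (a ^ (n - \<Xi> \<omega>) * b ^ \<Xi> \<omega>) - iexp (r * t * \<xi> \<omega>) * c)
        = cmod (a ^ (n - \<Xi> \<omega>) * b ^ \<Xi> \<omega> - c)"
      by (simp add: norm_mult flip: right_diff_distrib)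
    also have "\<dots> \<le> \<delta> + \<bar>\<alpha> - \<beta>\<bar> * \<bar>real (\<Xi> \<omega>) / real n - p\<bar>"
      unfolding \<delta>_def c_def using p by (intro norm_power_product_minus_exp_le ab \<alpha>\<beta> \<Xi>_le n) auto
    also have "\<dots> \<le> \<delta> + \<bar>\<alpha> - \<beta>\<bar> * min 1 (\<bar>\<xi> \<omega>\<bar> / sqrt (real n))"
      by (intro add_left_mono mult_left_mono dev) auto
    finally show ?thesis .
  qed
  have "cmod (char (distr P borel ?S) t - char (distr P borel \<xi>) (r * t) * c)
      = cmod (expectation (\<lambda>\<omega>. iexp (r * t * \<xi> \<omega>) * (a ^ (n - \<Xi> \<omega>) * b ^ \<Xi> \<omega>) - iexp (r * t * \<xi> \<omega>) * c))"
    unfolding 1 2 using int1 int2 by (subst Bochner_Integration.integral_diff) simp_all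
  also have "\<dots> \<le> expectation (\<lambda>\<omega>. \<delta> + \<bar>\<alpha> - \<beta>\<bar> * min 1 (\<bar>\<xi> \<omega>\<bar> / sqrt (real n)))"
    using int1 int2 int3 bound
    by (intro order_trans[OF integral_norm_bound integral_mono]) auto
  also have "\<dots> = \<delta> + \<bar>\<alpha> - \<beta>\<bar> * expectation (\<lambda>\<omega>. min 1 (\<bar>\<xi> \<omega>\<bar> / sqrt (real n)))"
    using int3 by (simp add: prob_space)
  also have "expectation (\<lambda>\<omega>. min 1 (\<bar>\<xi> \<omega>\<bar> / sqrt (real n))) = (LINT x|distr P borel \<xi>. min 1 (\<bar>x\<bar> / sqrt (real n)))"
    by (subst integral_distr) auto
  finally show ?thesis
    unfolding \<delta>_def a_def b_def c_def \<theta>_def \<xi>_def .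
qed

end

section \<open>Convergence of the sample mean\<close>

theorem theorem3p1:
  fixes l :: nat and F :: "real measure" and \<mu> \<sigma> \<mu>\<^sub>U \<mu>\<^sub>V r :: real
    and Q :: "'w measure" and W :: "'w \<Rightarrow> real" and A :: "real set"
    and v :: "nat \<Rightarrow> nat" and E :: "nat \<Rightarrow> nat set set" and n :: "nat \<Rightarrow> nat"
    and e :: "nat \<Rightarrow> nat \<Rightarrow> nat set"
    and P :: "nat \<Rightarrow> 'p measure" and M :: "nat \<Rightarrow> nat \<Rightarrow> 'p \<Rightarrow> nat"
    and U V :: "nat \<Rightarrow> nat \<Rightarrow> 'p \<Rightarrow> real"
    and R :: "'y measure" and Y Z :: "'y \<Rightarrow> real"
  assumes l: "l \<ge> 2"
    and F: "real_distribution F"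
    and mean_finite: "integrable F (\<lambda>x. x)"
    and mean: "\<mu> = (\<integral>x. x \<partial>F)"
    and variance_finite: "integrable F (\<lambda>x. (x - \<mu>)\<^sup>2)"
    and std_dev: "\<sigma> = sqrt (\<integral>x. (x - \<mu>)\<^sup>2 \<partial>F)"
    and Q: "prob_space Q"
    and W: "W \<in> borel_measurable Q" "distr Q borel W = F"
    and A: "A \<in> sets borel" "measure Q {\<omega> \<in> space Q. W \<omega> \<in> A} = 1 / real l"
    and graph: "\<And>m. m \<ge> 1 \<Longrightarrow> simple_graph {1..v m} (E m)"
    and girth: "\<And>m. m \<ge> 1 \<Longrightarrow> girth (E m) \<ge> 4"
    and n: "\<And>m. n m = card (E m)"
    and n_at_top: "filterlim n at_top sequentially"
    and construction: "\<And>m. m \<ge> 1 \<Longrightarrow>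
          edge_construction (P m) (v m) (E m) (n m) (e m) l
            (cond_law Q W (- A)) (cond_law Q W A) (M m) (U m) (V m)"
    and R: "prob_space R"
    and Y: "Y \<in> borel_measurable R"
    and xi_conv: "weak_conv_m (\<lambda>m. distr (P m) borel (edge_xi l (n m) (e m) (M m)))
                    (distr R borel Y)"
    and Z: "Z \<in> borel_measurable R" "distr R borel Z = std_normal_distribution"
    and YZ_indep: "prob_space.indep_var R borel Y borel Z"
    and cond_means: "\<mu>\<^sub>U = cond_mean Q W (- A)" "\<mu>\<^sub>V = cond_mean Q W A"
    and r: "r = sqrt (1 / real l * (1 - 1 / real l)) * (\<mu>\<^sub>V - \<mu>\<^sub>U) / \<sigma>"
  shows "weak_conv_m
           (\<lambda>m. distr (P m) borel (\<lambda>\<omega>.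
              ((\<Sum>k=1..n m. edge_X (e m) (M m) (U m) (V m) k \<omega>) - real (n m) * \<mu>) /
              (\<sigma> * sqrt (real (n m)))))
           (distr R borel (\<lambda>\<omega>. sqrt (1 - r\<^sup>2) * Z \<omega> + r * Y \<omega>))"
proof -
  interpret Q: prob_space Q by fact
  interpret R: prob_space R by fact
  interpret F: real_distribution F by fact
  note [measurable] = W(1) A(1) Y Z(1)

  \<comment> \<open>Means and variances of the conditional laws\<close>
  define p where "p = 1 / real l"
  have p: "0 < p" "p < 1" using l by (auto simp: p_def)
  have "{\<omega> \<in> space Q. W \<omega> \<in> A} = W -` A \<inter> space Q" by auto
  then have pA: "Q.prob (W -` A \<inter> space Q) = p" using A(2) by (simp add: p_def)
  have "W -` (- A) \<inter> space Q = space Q - (W -` A \<inter> space Q)" by auto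
  then have pA': "Q.prob (W -` (- A) \<inter> space Q) = 1 - p"
    using pA by (simp add: Q.prob_compl)
  have F_sq: "integrable F (\<lambda>x. x\<^sup>2)"
  proof -
    have "integrable F (\<lambda>x. (x - \<mu>)\<^sup>2 + 2 * \<mu> * x - \<mu>\<^sup>2)"
      using variance_finite mean_finite by simp
    then show ?thesis by (simp add: power2_eq_square algebra_simps)
  qed
  have Q_int: "integrable Q (\<lambda>\<omega>. f (W \<omega>))" if "integrable F f" "f \<in> borel_measurable borel" for f :: "real \<Rightarrow> real"
    using that integrable_distr_eq[OF W(1), of f] by (simp add: W(2))
  have Q_exp: "integral\<^sup>L F f = Q.expectation (\<lambda>\<omega>. f (W \<omega>))" if "f \<in> borel_measurable borel" for f :: "real \<Rightarrow> real"
    using that integral_distr[OF W(1), of f] by (simp add: W(2))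
  define FU where "FU = cond_law Q W (- A)"
  define FV where "FV = cond_law Q W A"
  interpret FU: real_distribution FU
    unfolding FU_def using pA' p by (intro Q.real_distribution_cond_law) auto
  interpret FV: real_distribution FV
    unfolding FV_def using pA p by (intro Q.real_distribution_cond_law) auto
  have cond_int: "integrable FU f" "integrable FV f" if "integrable F f" "f \<in> borel_measurable borel" for f :: "real \<Rightarrow> real"
    unfolding FU_def FV_def using pA pA' p
      Q.integrable_cond_law[OF W(1) _ _ Q_int[OF that] that(2), of "- A"]
      Q.integrable_cond_law[OF W(1) A(1) _ Q_int[OF that] that(2)] by auto
  have mixture: "integral\<^sup>L F f = (1 - p) * integral\<^sup>L FU f + p * integral\<^sup>L FV f"
    if "integrable F f" "f \<in> borel_measurable borel" for f
    unfolding FU_def FV_def Q_exp[OF that(2)]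
    using that p by (intro Q.expectation_eq_cond_law_mixture pA Q_int) auto
  have means: "\<mu>\<^sub>U = FU.expectation (\<lambda>x. x)" "\<mu>\<^sub>V = FV.expectation (\<lambda>x. x)"
    unfolding cond_means FU_def FV_def cond_mean_def cond_law_def
    by (subst integral_distr; simp)+
  define s\<^sub>U where "s\<^sub>U = FU.variance (\<lambda>x. x)"
  define s\<^sub>V where "s\<^sub>V = FV.variance (\<lambda>x. x)"
  have s: "s\<^sub>U \<ge> 0" "s\<^sub>V \<ge> 0" by (auto simp: s\<^sub>U_def s\<^sub>V_def)
  have \<mu>: "\<mu> = (1 - p) * \<mu>\<^sub>U + p * \<mu>\<^sub>V"
    unfolding mean means by (intro mixture mean_finite) simp
  \<comment> \<open>With zero variance, \<open>F\<close> would be concentrated at \<mu> and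
    \<open>A\<close> would have probability 0 or 1, contradicting \<open>0 < p < 1\<close>.\<close>
  have var0: "integral\<^sup>L F (\<lambda>x. (x - \<mu>)\<^sup>2) \<noteq> 0"
  proof
    assume "integral\<^sup>L F (\<lambda>x. (x - \<mu>)\<^sup>2) = 0"
    then have "AE x in F. (x - \<mu>)\<^sup>2 = 0"
      using variance_finite by (subst integral_nonneg_eq_0_iff_AE[symmetric]) auto
    then have AE: "AE x in F. x = \<mu>" by simp
    have "F.prob A = p"
      using pA measure_distr[OF W(1) A(1)] by (simp add: W(2))
    moreover have "F.prob A = F.prob (if \<mu> \<in> A then UNIV else {})"
      using AE by (intro F.finite_measure_eq_AE) auto
    ultimately show False using p F.prob_space by (auto split: if_splits)
  qed
  have \<sigma>2: "\<sigma>\<^sup>2 = integral\<^sup>L F (\<lambda>x. (x - \<mu>)\<^sup>2)"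
    unfolding std_dev by simp
  have \<sigma>: "\<sigma> > 0"
    using var0 unfolding std_dev by (simp add: order_less_le)
  have "\<sigma>\<^sup>2 = (1 - p) * FU.expectation (\<lambda>x. (x - \<mu>)\<^sup>2) + p * FV.expectation (\<lambda>x. (x - \<mu>)\<^sup>2)"
    unfolding \<sigma>2 by (intro mixture variance_finite) simp
  also have "FU.expectation (\<lambda>x. (x - \<mu>)\<^sup>2) = s\<^sub>U + (\<mu>\<^sub>U - \<mu>)\<^sup>2"
    unfolding s\<^sub>U_def means by (intro FU.expectation_square_shift(2) cond_int mean_finite F_sq) simp_all
  also have "FV.expectation (\<lambda>x. (x - \<mu>)\<^sup>2) = s\<^sub>V + (\<mu>\<^sub>V - \<mu>)\<^sup>2"
    unfolding s\<^sub>V_def means by (intro FV.expectation_square_shift(2) cond_int mean_finite F_sq) simp_all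
  \<comment> \<open>Here \<open>\<mu>\<^sub>U - \<mu> = - p * (\<mu>\<^sub>V -
    \<mu>\<^sub>U)\<close> and \<open>\<mu>\<^sub>V - \<mu> = (1 - p) * (\<mu>\<^sub>V -
    \<mu>\<^sub>U)\<close>.\<close>
  also have "(1 - p) * (s\<^sub>U + (\<mu>\<^sub>U - \<mu>)\<^sup>2) + p * (s\<^sub>V + (\<mu>\<^sub>V - \<mu>)\<^sup>2)
      = (1 - p) * s\<^sub>U + p * s\<^sub>V + p * (1 - p) * (\<mu>\<^sub>V - \<mu>\<^sub>U)\<^sup>2"
    unfolding \<mu> by (simp add: power2_eq_square algebra_simps)
  finally have \<sigma>_split: "\<sigma>\<^sup>2 = (1 - p) * s\<^sub>U + p * s\<^sub>V + p * (1 - p) * (\<mu>\<^sub>V - \<mu>\<^sub>U)\<^sup>2" .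
  \<comment> \<open>Thus \<open>r\<^sup>2\<close> is the share of the variance between the two
    conditional laws and \<open>1 - r\<^sup>2\<close> the share within them. In particular the
    latter is nonnegative, so its square root squares back.\<close>
  have r2: "1 - r\<^sup>2 = ((1 - p) * s\<^sub>U + p * s\<^sub>V) / \<sigma>\<^sup>2"
  proof -
    have "r\<^sup>2 = p * (1 - p) * (\<mu>\<^sub>V - \<mu>\<^sub>U)\<^sup>2 / \<sigma>\<^sup>2"
      unfolding r p_def[symmetric] using p by (simp add: power_divide power_mult_distrib)
    then have "1 - r\<^sup>2 = (\<sigma>\<^sup>2 - p * (1 - p) * (\<mu>\<^sub>V - \<mu>\<^sub>U)\<^sup>2) / \<sigma>\<^sup>2"
      using \<sigma> by (simp add: diff_divide_distrib)
    also have "\<sigma>\<^sup>2 - p * (1 - p) * (\<mu>\<^sub>V - \<mu>\<^sub>U)\<^sup>2 = (1 - p) * s\<^sub>U + p * s\<^sub>V"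
      using \<sigma>_split by linarith
    finally show ?thesis .
  qed
  then have r_le: "0 \<le> 1 - r\<^sup>2" using s p by simp

  \<comment> \<open>Passage to the limit along the shifted sequence\<close>
  have construction': "edge_construction (P (Suc m)) (v (Suc m)) (E (Suc m)) (n (Suc m)) (e (Suc m)) l FU FV
      (M (Suc m)) (U (Suc m)) (V (Suc m))" for m
    unfolding FU_def FV_def by (intro construction) simp
  interpret C: edge_construction "P (Suc m)" "v (Suc m)" "E (Suc m)" "n (Suc m)" "e (Suc m)" l FU FV
      "M (Suc m)" "U (Suc m)" "V (Suc m)" for m
    by (rule construction')
  have graph': "simple_graph {1..v (Suc m)} (E (Suc m))" for m by (intro graph) simp
  have n': "filterlim (\<lambda>m. n (Suc m)) at_top sequentially"
    using n_at_top by (rule filterlim_compose) (rule filterlim_Suc)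
  define \<Psi> where "\<Psi> m = distr (P m) borel (edge_xi l (n m) (e m) (M m))" for m
  define S where "S m = (\<lambda>\<omega>. ((\<Sum>k=1..n m. edge_X (e m) (M m) (U m) (V m) k \<omega>) - real (n m) * \<mu>) /
              (\<sigma> * sqrt (real (n m))))" for m
  have \<Psi>_dist: "real_distribution (\<Psi> (Suc m))" for m
    unfolding \<Psi>_def by (intro C.real_distribution_distr C.rv_edge_xi graph')
  have Y_dist: "real_distribution (distr R borel Y)"
    by (intro R.real_distribution_distr) simp
  have \<Psi>_conv: "weak_conv_m (\<lambda>m. \<Psi> (Suc m)) (distr R borel Y)"
    using xi_conv unfolding \<Psi>_def[abs_def, symmetric] weak_conv_m_Suc_iff .
  have "weak_conv_m (\<lambda>m. distr (P (Suc m)) borel (S (Suc m)))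
      (distr R borel (\<lambda>\<omega>. sqrt (1 - r\<^sup>2) * Z \<omega> + r * Y \<omega>))"
  proof (rule levy_continuity)
    show "real_distribution (distr (P (Suc m)) borel (S (Suc m)))" for m
    proof -
      note [measurable] = C.rv_edge_X[OF graph', of _ m]
      show ?thesis unfolding S_def by (intro C.real_distribution_distr) measurable
    qed
    show "real_distribution (distr R borel (\<lambda>\<omega>. sqrt (1 - r\<^sup>2) * Z \<omega> + r * Y \<omega>))"
      by (intro R.real_distribution_distr) simp
    fix t
    define \<alpha> where "\<alpha> = (t / \<sigma>)\<^sup>2 * s\<^sub>U / 2"
    define \<beta> where "\<beta> = (t / \<sigma>)\<^sup>2 * s\<^sub>V / 2"
    define c where "c = complex_of_real (exp (- ((1 - p) * \<alpha> + p * \<beta>)))"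
    define \<epsilon>U where "\<epsilon>U k = real k * cmod (char (distr FU borel (\<lambda>x. x - \<mu>\<^sub>U)) (t / \<sigma> / sqrt (real k))
        - complex_of_real (exp (- \<alpha> / real k)))" for k
    define \<epsilon>V where "\<epsilon>V k = real k * cmod (char (distr FV borel (\<lambda>x. x - \<mu>\<^sub>V)) (t / \<sigma> / sqrt (real k))
        - complex_of_real (exp (- \<beta> / real k)))" for k
    define \<tau> where "\<tau> m = (LINT x|\<Psi> (Suc m). min 1 (\<bar>x\<bar> / sqrt (real (n (Suc m)))))" for m
    have "\<epsilon>U \<longlonglongrightarrow> 0"
      unfolding \<epsilon>U_def \<alpha>_def s\<^sub>U_def means
      by (intro FU.char_centered_minus_exp_little_o cond_int mean_finite F_sq) auto
    moreover have "\<epsilon>V \<longlonglongrightarrow> 0"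
      unfolding \<epsilon>V_def \<beta>_def s\<^sub>V_def means
      by (intro FV.char_centered_minus_exp_little_o cond_int mean_finite F_sq) auto
    moreover have "\<tau> \<longlonglongrightarrow> 0"
      unfolding \<tau>_def
      by (intro weak_conv_m_rescaled_negligible[OF \<Psi>_dist Y_dist \<Psi>_conv]
            filterlim_compose[OF sqrt_at_top] filterlim_compose[OF filterlim_real_sequentially n'])
    \<comment> \<open>The two expansion errors are sequences in the number of edges and vanish along
      \<open>n (Suc m)\<close>; the third error is indexed by \<open>m\<close> directly.\<close>
    ultimately have "(\<lambda>m. \<epsilon>U (n (Suc m)) + \<epsilon>V (n (Suc m)) + \<bar>\<alpha> - \<beta>\<bar> * \<tau> m) \<longlonglongrightarrow> 0 + 0 + \<bar>\<alpha> - \<beta>\<bar> * 0"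
      by (intro tendsto_intros filterlim_compose[OF _ n'])
    then have lim0: "(\<lambda>m. \<epsilon>U (n (Suc m)) + \<epsilon>V (n (Suc m)) + \<bar>\<alpha> - \<beta>\<bar> * \<tau> m) \<longlonglongrightarrow> 0" by simp
    \<comment> \<open>The comparison divides by the number of edges, so it is available only from
      some index on.\<close>
    have "\<forall>\<^sub>F m in sequentially. n (Suc m) > 0"
      using filterlim_at_top[THEN iffD1, OF n', THEN spec, of 1] by (simp add: Suc_le_eq)
    then have "\<forall>\<^sub>F m in sequentially.
        cmod (char (distr (P (Suc m)) borel (S (Suc m))) t - char (\<Psi> (Suc m)) (r * t) * c)
        \<le> \<epsilon>U (n (Suc m)) + \<epsilon>V (n (Suc m)) + \<bar>\<alpha> - \<beta>\<bar> * \<tau> m"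
    proof eventually_elim
      case (elim m)
      show ?case
        unfolding S_def \<Psi>_def \<epsilon>U_def \<epsilon>V_def \<tau>_def c_def \<alpha>_def \<beta>_def p_def
        by (intro C.char_sample_mean_approx graph' l elim \<sigma> s FU.real_distribution_axioms
              FV.real_distribution_axioms r \<mu>[unfolded p_def])
    qed
    then have "(\<lambda>m. char (distr (P (Suc m)) borel (S (Suc m))) t - char (\<Psi> (Suc m)) (r * t) * c) \<longlonglongrightarrow> 0"
      by (rule Lim_null_comparison[OF _ lim0])
    moreover have "(\<lambda>m. char (\<Psi> (Suc m)) (r * t) * c) \<longlonglongrightarrow> char (distr R borel Y) (r * t) * c"
      by (intro tendsto_intros levy_continuity1 \<Psi>_dist Y_dist \<Psi>_conv)
    ultimately have "(\<lambda>m. char (distr (P (Suc m)) borel (S (Suc m))) t) \<longlonglongrightarrow> char (distr R borel Y) (r * t) * c"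
      by (rule Lim_transform[rotated])
    \<comment> \<open>Both exponents carry the factor \<open>(t / \<sigma>)\<^sup>2 / 2\<close>, so
      their mixture is \<open>t\<^sup>2 / 2\<close> times the within-law share of the variance, the
      exponent of the normal factor.\<close>
    moreover have "(1 - p) * \<alpha> + p * \<beta> = (sqrt (1 - r\<^sup>2))\<^sup>2 * t\<^sup>2 / 2"
      using r_le \<sigma> unfolding r2 \<alpha>_def \<beta>_def by (simp add: r2 power_divide field_simps)
    ultimately show "(\<lambda>m. char (distr (P (Suc m)) borel (S (Suc m))) t)
        \<longlonglongrightarrow> char (distr R borel (\<lambda>\<omega>. sqrt (1 - r\<^sup>2) * Z \<omega> + r * Y \<omega>)) t"
      unfolding c_def R.char_indep_normal_combination[OF YZ_indep Z(2)] by simp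
  qed
  then show ?thesis
    unfolding weak_conv_m_Suc_iff[of "\<lambda>m. distr (P m) borel (S m)"] unfolding S_def .
qed

end
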